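(* Let $U_h^n$, $n=1,2,\dots,N$, be the solution of the fully discrete scheme $$(b_0I+c_\alpha\tau^\alpha A_h)U_h^n=b_{n-1}U_h^0+\sum_{j=1}^{n-1}(b_{j-1}-b_j)U_h^{n-j}+c_\alpha\tau^\alpha F_h^n,\qquad U_h^0=v_h\in X_h,\quad F_h^n=P_hf(t_n)\in X_h,$$ with $c_\alpha=\Gamma(2-\alpha)$. Then for $n=1,2,\dots,N$, $$\|U_h^n\|_{L^2(\Omega)}\le\|v_h\|_{L^2(\Omega)}+c_\alpha\tau^\alpha\sum_{k=0}^{n-1}(n-k)^{\alpha-1}\|F_h^{k+1}\|_{L^2(\Omega)}.$$
   Context: Let $0<\alpha<1$, $T>0$, $N\in\mathbb N$, $\tau=T/N$, $t_n=n\tau$, and $b_j=(j+1)^{1-\alpha}-j^{1-\alpha}$ for $j\ge0$. $\Omega\subset\mathbb R^d$ ($d=1,2,3$) is a bounded convex polygonal domain, $X_h\subset H_0^1(\Omega)$ is the space of continuous piecewise linear finite elements on a shape regular quasi-uniform triangulation of $\Omega$ into $d$-simplexes, $P_h:L^2(\Omega)\to X_h$ is the $L^2(\Omega)$-orthogonal projection, $f$ is a source term with $f(t_n)\in L^2(\Omega)$, and $A_h:X_h\to X_h$ is the negative discrete Laplacian, $(A_h\varphi,\chi)=(\nabla\varphi,\nabla\chi)$ for all $\varphi,\chi\in X_h$, with $(\cdot,\cdot)$ the $L^2(\Omega)$ inner product. *)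

theory Defs
  imports "HOL-Analysis.Analysis"
begin

section \<open>The space $L^2(\Omega)$\<close>

definition L2_space :: "'a::euclidean_space set \<Rightarrow> ('a \<Rightarrow> real) set" where
  "L2_space \<Omega> = {g \<in> borel_measurable (lebesgue_on \<Omega>). integrable (lebesgue_on \<Omega>) (\<lambda>x. (g x)\<^sup>2)}"

definition L2_inner :: "'a::euclidean_space set \<Rightarrow> ('a \<Rightarrow> real) \<Rightarrow> ('a \<Rightarrow> real) \<Rightarrow> real" where
  "L2_inner \<Omega> \<phi> \<psi> = (LINT x|lebesgue_on \<Omega>. \<phi> x * \<psi> x)"

definition L2_norm :: "'a::euclidean_space set \<Rightarrow> ('a \<Rightarrow> real) \<Rightarrow> real" where
  "L2_norm \<Omega> \<phi> = sqrt (L2_inner \<Omega> \<phi> \<phi>)"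

section \<open>Domain and triangulation\<close>

definition convex_polygonal_domain :: "'a::euclidean_space set \<Rightarrow> bool" where
  "convex_polygonal_domain \<Omega> \<longleftrightarrow>
     \<Omega> \<noteq> {} \<and> open \<Omega> \<and> bounded \<Omega> \<and> convex \<Omega> \<and> polytope (closure \<Omega>)"

text \<open>The face condition in \<^const>\<open>triangulation\<close> is the usual conformity
  (no hanging nodes) of a finite element mesh.\<close>

definition mesh_of :: "'a::euclidean_space set \<Rightarrow> 'a set set \<Rightarrow> bool" where
  "mesh_of \<Omega> \<T> \<longleftrightarrow>
     triangulation \<T> \<and> (\<forall>K\<in>\<T>. int DIM('a) simplex K) \<and> \<Union>\<T> = closure \<Omega>"

text \<open>Shape regularity and quasi-uniformity are conditions on a family of meshes. They are
  expressed for one mesh by exhibiting the constants that are uniform over the family.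
  In the first definition, the largest admissible \<open>r\<close> is the inradius of \<open>K\<close>.\<close>

definition shape_regular :: "real \<Rightarrow> 'a::euclidean_space set set \<Rightarrow> bool" where
  "shape_regular \<sigma> \<T> \<longleftrightarrow> (\<forall>K\<in>\<T>. \<exists>x r. 0 < r \<and> cball x r \<subseteq> K \<and> diameter K \<le> \<sigma> * r)"

definition quasi_uniform :: "real \<Rightarrow> 'a::euclidean_space set set \<Rightarrow> bool" where
  "quasi_uniform \<kappa> \<T> \<longleftrightarrow> (\<forall>K\<in>\<T>. \<forall>K'\<in>\<T>. diameter K \<le> \<kappa> * diameter K')"

section \<open>Finite element space and operators\<close>

text \<open>Finite element functions are extended by zero outside \<open>\<Omega>\<close>. This encodes the homogeneous
  Dirichlet condition, and makes equality of functions on the whole space agree with equality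
  in $L^2(\Omega)$ for members of the finite element space.\<close>

definition fe_space :: "'a::euclidean_space set \<Rightarrow> 'a set set \<Rightarrow> ('a \<Rightarrow> real) set" where
  "fe_space \<Omega> \<T> =
     {\<phi>. continuous_on (closure \<Omega>) \<phi> \<and>
         (\<forall>K\<in>\<T>. \<exists>a b. \<forall>x\<in>K. \<phi> x = a \<bullet> x + b) \<and>
         (\<forall>x. x \<notin> \<Omega> \<longrightarrow> \<phi> x = 0)}"

text \<open>The pointwise gradient. A finite element function is differentiable in the interior of every
  simplex, hence almost everywhere on \<open>\<Omega>\<close>, and there this is its weak gradient. The unspecified
  values on the null set of inter-element boundaries do not affect the integral below.\<close>

definition grad :: "('a::euclidean_space \<Rightarrow> real) \<Rightarrow> 'a \<Rightarrow> 'a" where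
  "grad \<phi> x = (THE D. GDERIV \<phi> x :> D)"

definition grad_inner :: "'a::euclidean_space set \<Rightarrow> ('a \<Rightarrow> real) \<Rightarrow> ('a \<Rightarrow> real) \<Rightarrow> real" where
  "grad_inner \<Omega> \<phi> \<psi> = (LINT x|lebesgue_on \<Omega>. grad \<phi> x \<bullet> grad \<psi> x)"

text \<open>Both operators are determined on their domains by the conditions below; their values
  elsewhere are irrelevant.\<close>

definition is_L2_projection ::
  "'a::euclidean_space set \<Rightarrow> ('a \<Rightarrow> real) set \<Rightarrow> (('a \<Rightarrow> real) \<Rightarrow> 'a \<Rightarrow> real) \<Rightarrow> bool" where
  "is_L2_projection \<Omega> X P \<longleftrightarrow>
     (\<forall>g\<in>L2_space \<Omega>. P g \<in> X \<and> (\<forall>\<psi>\<in>X. L2_inner \<Omega> (P g) \<psi> = L2_inner \<Omega> g \<psi>))"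

definition is_neg_discrete_Laplacian ::
  "'a::euclidean_space set \<Rightarrow> ('a \<Rightarrow> real) set \<Rightarrow> (('a \<Rightarrow> real) \<Rightarrow> 'a \<Rightarrow> real) \<Rightarrow> bool" where
  "is_neg_discrete_Laplacian \<Omega> X A \<longleftrightarrow>
     (\<forall>\<phi>\<in>X. A \<phi> \<in> X \<and> (\<forall>\<psi>\<in>X. L2_inner \<Omega> (A \<phi>) \<psi> = grad_inner \<Omega> \<phi> \<psi>))"

section \<open>The fully discrete L1 scheme\<close>

definition L1_coeff :: "real \<Rightarrow> nat \<Rightarrow> real" where
  "L1_coeff \<alpha> j = real (j + 1) powr (1 - \<alpha>) - real j powr (1 - \<alpha>)"

definition c_coeff :: "real \<Rightarrow> real" where
  "c_coeff \<alpha> = Gamma (2 - \<alpha>)"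

definition L1_scheme_solution ::
  "('a \<Rightarrow> real) set \<Rightarrow> (('a \<Rightarrow> real) \<Rightarrow> 'a \<Rightarrow> real) \<Rightarrow> real \<Rightarrow> real \<Rightarrow> nat \<Rightarrow>
   ('a \<Rightarrow> real) \<Rightarrow> (nat \<Rightarrow> 'a \<Rightarrow> real) \<Rightarrow> (nat \<Rightarrow> 'a \<Rightarrow> real) \<Rightarrow> bool" where
  "L1_scheme_solution X A \<alpha> \<tau> N v F U \<longleftrightarrow>
     U 0 = v \<and>
     (\<forall>n\<in>{1..N}. U n \<in> X \<and>
        (\<forall>x. L1_coeff \<alpha> 0 * U n x + c_coeff \<alpha> * \<tau> powr \<alpha> * A (U n) x =
             L1_coeff \<alpha> (n - 1) * U 0 x
             + (\<Sum>j=1..n - 1. (L1_coeff \<alpha> (j - 1) - L1_coeff \<alpha> j) * U (n - j) x)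
             + c_coeff \<alpha> * \<tau> powr \<alpha> * F n x))"

end

theory Submission
  imports Defs
begin

text \<open>Testing the scheme with \<open>U\<^sub>h\<^sup>n\<close> gives, for \<open>u\<^sub>n = \<parallel>U\<^sub>h\<^sup>n\<parallel>\<close> and
  \<open>g\<^sub>n = c\<^sub>\<alpha> \<tau>\<^sup>\<alpha> \<parallel>F\<^sub>h\<^sup>n\<parallel>\<close>, the convolution inequality
  \<open>u\<^sub>n \<le> b\<^bsub>n-1\<^esub> u\<^sub>0 + \<Sum>\<^sub>j (b\<^bsub>j-1\<^esub> - b\<^sub>j) u\<^bsub>n-j\<^esub> + g\<^sub>n\<close>. With the generating function
  \<open>b(z) = \<Sum>\<^sub>j b\<^sub>j z\<^sup>j\<close> it is solved by the kernel \<open>P(z) = 1 / ((1 - z) b(z))\<close>: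
  \<open>u\<^sub>n \<le> u\<^sub>0 + \<Sum>\<^sub>k P\<^bsub>n-k\<^esub> g\<^sub>k\<close>. As \<open>b\<close> is log-convex, Kaluza's theorem shows that the
  coefficients of \<open>1 / b(z)\<close> of positive index are nonpositive, so \<open>P\<close> is decreasing. Therefore
  \<open>1 = \<Sum>\<^bsub>j\<le>m\<^esub> b\<^sub>j P\<^bsub>m-j\<^esub> \<ge> P\<^sub>m \<Sum>\<^bsub>j\<le>m\<^esub> b\<^sub>j = P\<^sub>m (m + 1)\<^bsup>1-\<alpha>\<^esup>\<close>, which is the asserted
  weight.\<close>

section \<open>Convolution inequalities with a log-convex kernel\<close>

unbundle no vec_syntax
unbundle fps_syntax

text \<open>Kaluza's argument: the convolution identities for \<open>inverse b * b = 1\<close> of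
  orders \<open>m + 1\<close> and \<open>m\<close> are combined so that the positive coefficient of
  index 0 drops out. The others are nonpositive by induction, and monotone ratios make their factors
  nonpositive.\<close>

lemma fps_inverse_nth_nonpos_of_log_convex:
  fixes b :: "real fps"
  assumes pos: "\<And>n. 0 < b $ n"
    and ratio: "incseq (\<lambda>n. b $ Suc n / b $ n)"
    and "0 < n"
  shows "inverse b $ n \<le> 0"
  using \<open>0 < n\<close>
proof (induction n rule: less_induct)
  case (less n)
  define c where "c = inverse b"
  have "c * b = 1"
    using pos[of 0] by (simp add: c_def inverse_mult_eq_1)
  then have conv: "(\<Sum>i=0..m. c $ i * b $ (m - i)) = (if m = 0 then 1 else 0)" for m
    by (metis fps_mult_nth fps_one_nth)
  have c0: "0 < c $ 0"
    using pos[of 0] by (simp add: c_def)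
  obtain m where n: "n = Suc m"
    using less.prems gr0_implies_Suc by blast
  have "c $ n * b $ 0 \<le> 0"
  proof (cases "m = 0")
    \<comment> \<open>Order 0 has right-hand side 1, so index 1 is read off directly:
      \<open>c $ 1 * b $ 0 = - (c $ 0 * b $ 1)\<close>.\<close>
    case True
    then show ?thesis
      using conv[of 1] n mult_pos_pos[OF c0 pos[of 1]] by simp
  next
    case False
    \<comment> \<open>This multiple makes the factor of \<open>c $ 0\<close> vanish and, as the
      ratio at \<open>m\<close>, dominates all earlier ratios.\<close>
    define r where "r = b $ Suc m / b $ m"
    have r: "r * b $ m = b $ Suc m"
      using pos[of m] by (simp add: r_def)
    have "c $ n * b $ 0 + (\<Sum>i=0..m. c $ i * (b $ (Suc m - i) - r * b $ (m - i)))
        = (\<Sum>i=0..Suc m. c $ i * b $ (Suc m - i)) - r * (\<Sum>i=0..m. c $ i * b $ (m - i))"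
      by (simp add: n algebra_simps sum_subtractf sum_distrib_left)
    also have "\<dots> = 0"
      using conv[of "Suc m"] conv[of m] False by simp
    finally have *: "c $ n * b $ 0
        = - (\<Sum>i=0..m. c $ i * (b $ (Suc m - i) - r * b $ (m - i)))"
      by simp
    have "0 \<le> c $ i * (b $ (Suc m - i) - r * b $ (m - i))" if i: "i \<in> {0..m}" for i
    proof (cases "i = 0")
      case True
      then show ?thesis by (simp add: r)
    next
      case False
      have "c $ i \<le> 0"
        using less.IH[of i] i False n by (simp add: c_def)
      moreover have "b $ Suc (m - i) / b $ (m - i) \<le> r"
        unfolding r_def using incseqD[OF ratio, of "m - i" m] by simp
      then have "b $ (Suc m - i) \<le> r * b $ (m - i)"
        using pos[of "m - i"] i by (simp add: field_simps Suc_diff_le)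
      ultimately show ?thesis
        by (intro mult_nonpos_nonpos) auto
    qed
    then show ?thesis
      unfolding * neg_le_0_iff_le by (rule sum_nonneg)
  qed
  then show ?case
    using pos[of 0] by (simp add: c_def mult_le_0_iff)
qed

section \<open>The summation kernel: sign, size and use as a resolvent\<close>

lemma fps_one_minus_X_mult_nth:
  fixes b :: "'a::comm_ring_1 fps"
  shows "((1 - fps_X) * b) $ n = (if n = 0 then b $ 0 else b $ n - b $ (n - 1))"
  by (simp add: algebra_simps)

text \<open>For nonzero \<open>b $ 0\<close>, the kernel complementary to \<open>b\<close>: its
  convolution with \<open>b\<close> is the constant sequence 1, and its coefficients are the partial
  sums of those of \<open>inverse b\<close>.\<close>

definition summation_kernel :: "real fps \<Rightarrow> real fps" where
  "summation_kernel b = inverse ((1 - fps_X) * b)"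

lemma summation_kernel_mult:
  assumes "b $ 0 \<noteq> 0"
  shows "summation_kernel b * ((1 - fps_X) * b) = 1"
  unfolding summation_kernel_def using assms
  by (intro inverse_mult_eq_1) simp

text \<open>By monotonicity of \<open>b\<close>, the series \<open>(1 - fps_X) * b\<close> has a
  positive constant coefficient and nonpositive higher ones, so its inverse obeys a recursion with
  nonnegative weights.\<close>

lemma summation_kernel_nonneg:
  fixes b :: "real fps"
  assumes pos: "0 < b $ 0" and dec: "decseq (\<lambda>n. b $ n)"
  shows "0 \<le> summation_kernel b $ n"
proof (induction n rule: less_induct)
  case (less n)
  let ?P = "summation_kernel b" and ?d = "(1 - fps_X) * b"
  show ?case
  proof (cases "n = 0")
    case True
    then show ?thesis using pos by (simp add: summation_kernel_def)
  next
    case False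
    then obtain m where n: "n = Suc m" using not0_implies_Suc by blast
    have "(\<Sum>i=0..n. ?P $ i * ?d $ (n - i)) = 0"
      using arg_cong[OF summation_kernel_mult, of b "\<lambda>f. f $ n"] pos False
      by (simp only: fps_mult_nth[of ?P]) simp
    then have "?P $ n * b $ 0 + (\<Sum>i=0..m. ?P $ i * ?d $ (n - i)) = 0"
      by (simp add: n fps_one_minus_X_mult_nth add.commute)
    then have "?P $ n * b $ 0 = (\<Sum>i=0..m. ?P $ i * - ?d $ (n - i))"
      by (simp add: sum_negf add_eq_0_iff2)
    also have "\<dots> \<ge> 0"
    proof (intro sum_nonneg mult_nonneg_nonneg)
      fix i assume i: "i \<in> {0..m}"
      then show "0 \<le> ?P $ i" using less.IH n by simp
      show "0 \<le> - ?d $ (n - i)"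
        using i n decseqD[OF dec, of "n - i - 1" "n - i"]
        by (simp add: fps_one_minus_X_mult_nth)
    qed
    finally show ?thesis
      using pos by (simp add: zero_le_mult_iff)
  qed
qed

lemma summation_kernel_le:
  fixes b :: "real fps"
  assumes pos: "\<And>n. 0 < b $ n"
    and ratio: "incseq (\<lambda>n. b $ Suc n / b $ n)"
  shows "summation_kernel b $ m * (\<Sum>j=0..m. b $ j) \<le> 1"
proof -
  let ?P = "summation_kernel b"
  have inv: "?P * ((1 - fps_X) * b) = 1"
    using pos[of 0] by (intro summation_kernel_mult) simp
  then have "(1 - fps_X) * ?P = inverse b"
    using pos[of 0]
    by (intro fps_inverse_unique[symmetric]) (simp add: mult_ac)
  then have "?P $ Suc n - ?P $ n = inverse b $ Suc n" for n
    by (metis diff_Suc_1 fps_one_minus_X_mult_nth nat.distinct(1))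
  then have "decseq (\<lambda>n. ?P $ n)"
    using fps_inverse_nth_nonpos_of_log_convex[OF pos ratio]
    by (intro decseq_SucI) (metis diff_le_0_iff_le zero_less_Suc)
  then have "?P $ m * (\<Sum>j=0..m. b $ j) \<le> (\<Sum>j=0..m. b $ j * ?P $ (m - j))"
    using pos unfolding sum_distrib_left
    by (intro sum_mono) (simp add: mult.commute decseqD less_imp_le)
  also have "\<dots> = (b * ?P) $ m"
    by (simp add: fps_mult_nth)
  also have "b * ?P = inverse (1 - fps_X)"
    using inv by (intro fps_inverse_unique[symmetric]) (simp add: mult_ac)
  also have "inverse (1 - fps_X) = (Abs_fps (\<lambda>n. 1) :: real fps)"
    by (metis fps_inverse_gp' fps_inverse_idempotent fps_nth_Abs_fps one_neq_zero)
  finally show ?thesis by simp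
qed

text \<open>The weights of the earlier values sum to 1, so subtracting the constant
  \<open>u 0\<close> removes the initial term. What is left bounds the coefficients 1 to
  \<open>n\<close> of \<open>(1 - fps_X) * b * W\<close> by \<open>g\<close>; convolution with the
  nonnegative kernel keeps the inequality and recovers \<open>W\<close>.\<close>

lemma convolution_inequality_bound:
  fixes b :: "real fps" and u g :: "nat \<Rightarrow> real"
  assumes b0: "b $ 0 = 1" and dec: "decseq (\<lambda>n. b $ n)"
    and u: "\<And>m. 1 \<le> m \<Longrightarrow> m \<le> n \<Longrightarrow>
      u m \<le> b $ (m - 1) * u 0 + (\<Sum>j=1..m - 1. (b $ (j - 1) - b $ j) * u (m - j)) + g m"
  shows "u n \<le> u 0 + (\<Sum>m=1..n. summation_kernel b $ (n - m) * g m)"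
proof -
  let ?P = "summation_kernel b" and ?d = "(1 - fps_X) * b"
  define W where "W = Abs_fps (\<lambda>k. u k - u 0)"
  define H where "H = ?d * W"
  have H0: "H $ 0 = 0" by (simp add: H_def W_def)
  have H: "H $ m \<le> g m" if m: "1 \<le> m" "m \<le> n" for m
  proof -
    obtain k where k: "m = Suc k" using m not0_implies_Suc by force
    have tele: "(\<Sum>j=1..k. b $ (j - 1) - b $ j) = 1 - b $ k"
      by (induction k) (auto simp: b0)
    have "H $ m = (\<Sum>j=0..m. ?d $ j * W $ (m - j))"
      unfolding H_def by (rule fps_mult_nth)
    \<comment> \<open>The leading factor is \<open>b $ 0 = 1\<close>, and the term
      \<open>j = m\<close> vanishes because \<open>W $ 0 = 0\<close>.\<close>
    also have "\<dots> = W $ m + (\<Sum>j=1..k. ?d $ j * W $ (m - j))"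
      by (simp add: k W_def sum.atLeast_Suc_atMost[of 0 k] fps_one_minus_X_mult_nth b0)
    also have "(\<Sum>j=1..k. ?d $ j * W $ (m - j))
        = (\<Sum>j=1..k. (b $ (j - 1) - b $ j) * u 0 - (b $ (j - 1) - b $ j) * u (m - j))"
      by (intro sum.cong) (auto simp: fps_one_minus_X_mult_nth W_def algebra_simps)
    also have "\<dots> = (1 - b $ k) * u 0 - (\<Sum>j=1..k. (b $ (j - 1) - b $ j) * u (m - j))"
      by (simp only: sum_subtractf[of "\<lambda>j. _ j * u 0"] sum_distrib_right[symmetric] tele)
    finally show ?thesis
      using u[OF m] by (simp add: k W_def algebra_simps)
  qed
  have "W = ?P * H"
    unfolding H_def mult.assoc[symmetric] using summation_kernel_mult[of b] b0
    by (simp add: mult.assoc)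
  then have "W $ n = (H * ?P) $ n"
    by (simp add: mult.commute)
  also have "\<dots> = (\<Sum>m=1..n. ?P $ (n - m) * H $ m)"
    by (simp add: fps_mult_nth sum.atLeast_Suc_atMost[of 0 n] H0 mult.commute)
  also have "\<dots> \<le> (\<Sum>m=1..n. ?P $ (n - m) * g m)"
    using H b0 by (intro sum_mono mult_left_mono summation_kernel_nonneg dec) auto
  finally show ?thesis by (simp add: W_def)
qed

section \<open>The L1 coefficients\<close>

lemma L1_coeff_0: "L1_coeff \<alpha> 0 = 1"
  by (simp add: L1_coeff_def)

lemma L1_coeff_pos:
  assumes "\<alpha> < 1" shows "0 < L1_coeff \<alpha> n"
  using assms by (simp add: L1_coeff_def powr_less_mono2)

lemma sum_L1_coeff: "(\<Sum>j=0..m. L1_coeff \<alpha> j) = real (m + 1) powr (1 - \<alpha>)"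
  by (induction m) (simp_all add: L1_coeff_def add_ac)

text \<open>Cauchy's mean value theorem for \<open>t \<mapsto> (t + 1)\<^bsup>1-\<alpha>\<^esup>\<close> and
  \<open>t \<mapsto> t\<^bsup>1-\<alpha>\<^esup>\<close> on \<open>[n, n + 1]\<close>.\<close>

lemma L1_coeff_ratio:
  assumes "\<alpha> < 1"
  obtains \<xi> where "real n < \<xi>" "\<xi> < real n + 1"
    "L1_coeff \<alpha> (Suc n) / L1_coeff \<alpha> n = (\<xi> / (\<xi> + 1)) powr \<alpha>"
proof -
  let ?g = "\<lambda>t::real. t powr (1 - \<alpha>)"
  have "\<exists>\<xi>>real n. \<xi> < real n + 1 \<and>
      (?g (real n + 1 + 1) - ?g (real n + 1)) * ((1 - \<alpha>) * \<xi> powr - \<alpha>)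
      = (?g (real n + 1) - ?g (real n)) * ((1 - \<alpha>) * (\<xi> + 1) powr - \<alpha>)"
  proof (rule GMVT'[of "real n" "real n + 1" "\<lambda>t. ?g (t + 1)" ?g])
    fix z assume z: "real n \<le> z" "z \<le> real n + 1"
    show "isCont (\<lambda>t. ?g (t + 1)) z"
      using z by (intro continuous_intros) auto
    show "isCont ?g z"
    proof -
      \<comment> \<open>For \<open>n = 0\<close> the endpoint \<open>z = 0\<close> needs two-sided
        continuity. It holds because \<open>powr\<close> depends only on the absolute value of its
        base and the exponent is positive.\<close>
      have "isCont (\<lambda>t. \<bar>t\<bar> powr (1 - \<alpha>)) z"
        using assms unfolding isCont_def by (intro tendsto_powr' tendsto_intros) auto
      moreover have "?g = (\<lambda>t. \<bar>t\<bar> powr (1 - \<alpha>))"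
        by (auto simp: powr_def abs_if ln_minus)
      ultimately show ?thesis by simp
    qed
  next
    fix z assume z: "real n < z" "z < real n + 1"
    then have "0 < z" by linarith
    then show "(?g has_real_derivative (1 - \<alpha>) * z powr - \<alpha>) (at z)"
      by (auto intro!: derivative_eq_intros)
    show "((\<lambda>t. ?g (t + 1)) has_real_derivative (1 - \<alpha>) * (z + 1) powr - \<alpha>) (at z)"
      using \<open>0 < z\<close> by (auto intro!: derivative_eq_intros)
  qed simp
  then obtain \<xi> where \<xi>: "real n < \<xi>" "\<xi> < real n + 1"
    and eq: "L1_coeff \<alpha> (Suc n) * ((1 - \<alpha>) * \<xi> powr - \<alpha>)
      = L1_coeff \<alpha> n * ((1 - \<alpha>) * (\<xi> + 1) powr - \<alpha>)"
    by (auto simp: L1_coeff_def add_ac)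
  have "0 < \<xi>" using \<xi> by linarith
  have "L1_coeff \<alpha> (Suc n) * \<xi> powr - \<alpha> = L1_coeff \<alpha> n * (\<xi> + 1) powr - \<alpha>"
    using eq assms by simp
  then have "L1_coeff \<alpha> (Suc n) / L1_coeff \<alpha> n = (\<xi> / (\<xi> + 1)) powr \<alpha>"
    using \<open>0 < \<xi>\<close> L1_coeff_pos[OF assms, of n]
    by (simp add: powr_minus powr_divide field_simps)
  with \<xi> show thesis by (rule that)
qed

text \<open>Log-convexity of the coefficients: the intermediate points of consecutive ratios lie in
  consecutive intervals, and \<open>t / (t + 1)\<close> increases with \<open>t > 0\<close>.\<close>

lemma incseq_L1_coeff_ratio:
  assumes "0 \<le> \<alpha>" "\<alpha> < 1"
  shows "incseq (\<lambda>n. L1_coeff \<alpha> (Suc n) / L1_coeff \<alpha> n)"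
proof (rule incseq_SucI)
  fix n
  obtain \<xi> where \<xi>: "real n < \<xi>" "\<xi> < real n + 1"
    "L1_coeff \<alpha> (Suc n) / L1_coeff \<alpha> n = (\<xi> / (\<xi> + 1)) powr \<alpha>"
    using L1_coeff_ratio[OF assms(2)] .
  obtain \<eta> where \<eta>: "real (Suc n) < \<eta>"
    "L1_coeff \<alpha> (Suc (Suc n)) / L1_coeff \<alpha> (Suc n) = (\<eta> / (\<eta> + 1)) powr \<alpha>"
    using L1_coeff_ratio[OF assms(2)] .
  have "0 < \<xi>" "\<xi> \<le> \<eta>" using \<xi> \<eta> by auto
  then have "\<xi> / (\<xi> + 1) \<le> \<eta> / (\<eta> + 1)" by (simp add: field_simps)
  then show "L1_coeff \<alpha> (Suc n) / L1_coeff \<alpha> n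
      \<le> L1_coeff \<alpha> (Suc (Suc n)) / L1_coeff \<alpha> (Suc n)"
    unfolding \<xi> \<eta> using \<open>0 < \<xi>\<close> assms by (intro powr_mono2) auto
qed

lemma decseq_L1_coeff:
  assumes "0 \<le> \<alpha>" "\<alpha> < 1"
  shows "decseq (L1_coeff \<alpha>)"
proof (rule decseq_SucI)
  fix n
  obtain \<xi> where \<xi>: "real n < \<xi>"
    "L1_coeff \<alpha> (Suc n) / L1_coeff \<alpha> n = (\<xi> / (\<xi> + 1)) powr \<alpha>"
    using L1_coeff_ratio[OF assms(2)] .
  have "0 < \<xi>" using \<xi> by linarith
  then have "(\<xi> / (\<xi> + 1)) powr \<alpha> \<le> 1"
    using assms by (intro powr_le1) auto
  then show "L1_coeff \<alpha> (Suc n) \<le> L1_coeff \<alpha> n"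
    unfolding \<xi>(2)[symmetric] using L1_coeff_pos[OF assms(2), of n] by (simp add: field_simps)
qed

text \<open>The coefficients telescope to partial sums \<open>(m + 1) powr (1 - \<alpha>)\<close>,
  whose reciprocals bound the kernel. Nonnegativity of \<open>g\<close> allows this bound to replace
  the kernel.\<close>

lemma L1_convolution_inequality_bound:
  fixes u g :: "nat \<Rightarrow> real"
  assumes \<alpha>: "0 \<le> \<alpha>" "\<alpha> < 1"
    and g: "\<And>m. 1 \<le> m \<Longrightarrow> m \<le> n \<Longrightarrow> 0 \<le> g m"
    and u: "\<And>m. 1 \<le> m \<Longrightarrow> m \<le> n \<Longrightarrow>
      u m \<le> L1_coeff \<alpha> (m - 1) * u 0
        + (\<Sum>j=1..m - 1. (L1_coeff \<alpha> (j - 1) - L1_coeff \<alpha> j) * u (m - j)) + g m"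
  shows "u n \<le> u 0 + (\<Sum>m=1..n. real (n - m + 1) powr (\<alpha> - 1) * g m)"
proof -
  let ?b = "Abs_fps (L1_coeff \<alpha>)"
  have P: "summation_kernel ?b $ m \<le> real (m + 1) powr (\<alpha> - 1)" for m
  proof -
    have "summation_kernel ?b $ m * real (m + 1) powr (1 - \<alpha>) \<le> 1"
      using summation_kernel_le[of ?b m] L1_coeff_pos[OF \<alpha>(2)] incseq_L1_coeff_ratio[OF \<alpha>]
      by (simp add: sum_L1_coeff)
    then have "summation_kernel ?b $ m \<le> 1 / real (m + 1) powr (1 - \<alpha>)"
      by (simp add: pos_le_divide_eq)
    also have "\<dots> = real (m + 1) powr (\<alpha> - 1)"
      using powr_minus_divide[of "real (m + 1)" "1 - \<alpha>"] by simp
    finally show ?thesis .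
  qed
  have "u n \<le> u 0 + (\<Sum>m=1..n. summation_kernel ?b $ (n - m) * g m)"
    using u decseq_L1_coeff[OF \<alpha>]
    by (intro convolution_inequality_bound) (auto simp: L1_coeff_0)
  also have "(\<Sum>m=1..n. summation_kernel ?b $ (n - m) * g m)
      \<le> (\<Sum>m=1..n. real (n - m + 1) powr (\<alpha> - 1) * g m)"
    using g by (intro sum_mono mult_right_mono P) auto
  finally show ?thesis by simp
qed

section \<open>The energy estimate\<close>

lemma L2_inner_nonneg: "0 \<le> L2_inner \<Omega> \<phi> \<phi>"
  by (simp add: L2_inner_def)

lemma L2_norm_nonneg: "0 \<le> L2_norm \<Omega> \<phi>"
  by (simp add: L2_norm_def L2_inner_nonneg)

lemma grad_inner_nonneg: "0 \<le> grad_inner \<Omega> \<phi> \<phi>"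
  by (simp add: grad_inner_def)

lemma L2_space_integrable_mult:
  assumes "\<phi> \<in> L2_space \<Omega>" "\<psi> \<in> L2_space \<Omega>"
  shows "integrable (lebesgue_on \<Omega>) (\<lambda>x. \<phi> x * \<psi> x)"
proof (rule Bochner_Integration.integrable_bound)
  show "integrable (lebesgue_on \<Omega>) (\<lambda>x. (\<phi> x)\<^sup>2 + (\<psi> x)\<^sup>2)"
    using assms by (auto simp: L2_space_def)
  show "(\<lambda>x. \<phi> x * \<psi> x) \<in> borel_measurable (lebesgue_on \<Omega>)"
    using assms by (auto simp: L2_space_def)
  have "\<bar>a * b\<bar> \<le> a\<^sup>2 + b\<^sup>2" for a b :: real
    using sum_squares_bound[of "\<bar>a\<bar>" "\<bar>b\<bar>"] mult_nonneg_nonneg[OF abs_ge_zero abs_ge_zero, of a b]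
    unfolding abs_mult power2_abs by linarith
  then show "AE x in lebesgue_on \<Omega>. norm (\<phi> x * \<psi> x) \<le> norm ((\<phi> x)\<^sup>2 + (\<psi> x)\<^sup>2)"
    by simp
qed

lemma L2_inner_Cauchy_Schwarz:
  assumes \<phi>: "\<phi> \<in> L2_space \<Omega>" and \<psi>: "\<psi> \<in> L2_space \<Omega>"
  shows "L2_inner \<Omega> \<phi> \<psi> \<le> L2_norm \<Omega> \<phi> * L2_norm \<Omega> \<psi>"
proof -
  define A B C where "A = L2_inner \<Omega> \<phi> \<phi>" and "B = L2_inner \<Omega> \<phi> \<psi>" and "C = L2_inner \<Omega> \<psi> \<psi>"
  have quad: "0 \<le> A * s\<^sup>2 - 2 * B * s * t + C * t\<^sup>2" for s t :: real
  proof -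
    have "0 \<le> (LINT x|lebesgue_on \<Omega>. (s * \<phi> x - t * \<psi> x)\<^sup>2)"
      by simp
    also have "\<dots> = (LINT x|lebesgue_on \<Omega>.
        s\<^sup>2 * (\<phi> x * \<phi> x) - 2 * s * t * (\<phi> x * \<psi> x) + t\<^sup>2 * (\<psi> x * \<psi> x))"
      by (intro Bochner_Integration.integral_cong) (auto simp: power2_eq_square algebra_simps)
    also have "\<dots> = s\<^sup>2 * A - 2 * s * t * B + t\<^sup>2 * C"
      using L2_space_integrable_mult[OF \<phi> \<phi>] L2_space_integrable_mult[OF \<phi> \<psi>]
        L2_space_integrable_mult[OF \<psi> \<psi>]
      by (simp add: A_def B_def C_def L2_inner_def)
    finally show ?thesis by (simp add: algebra_simps)
  qed
  have AC: "0 \<le> A" "0 \<le> C"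
    by (simp_all add: A_def C_def L2_inner_nonneg)
  have "B\<^sup>2 \<le> A * C"
  proof (cases "C = 0")
    case True
    have "B = 0"
    proof (rule ccontr)
      assume "B \<noteq> 0"
      \<comment> \<open>For \<open>C = 0\<close> the quadratic form takes the value
        \<open>- A - 2\<close> at this point.\<close>
      then show False
        using quad[of 1 "(A + 1) / B"] AC True by simp
    qed
    then show ?thesis using AC by simp
  next
    case False
    \<comment> \<open>At \<open>s = C\<close>, \<open>t = B\<close> the quadratic form factors in
      this way.\<close>
    have "0 \<le> C * (A * C - B\<^sup>2)"
      using quad[of C B] by (simp add: power2_eq_square algebra_simps)
    then show ?thesis
      using False AC by (simp add: zero_le_mult_iff)
  qed
  then have "B \<le> sqrt (A * C)"
    by (rule real_le_rsqrt)
  then show ?thesis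
    by (simp add: A_def B_def C_def L2_norm_def real_sqrt_mult)
qed

text \<open>Continuity on the compact closure gives boundedness, and the domain has finite
  measure.\<close>

lemma fe_space_subset_L2_space:
  assumes "open \<Omega>" "bounded \<Omega>"
  shows "fe_space \<Omega> \<T> \<subseteq> L2_space \<Omega>"
proof
  fix \<phi> assume "\<phi> \<in> fe_space \<Omega> \<T>"
  then have cont: "continuous_on (closure \<Omega>) \<phi>"
    by (simp add: fe_space_def)
  have \<Omega>: "\<Omega> \<in> lmeasurable"
    using assms by (simp add: lmeasurable_open)
  then have fin: "finite_measure (lebesgue_on \<Omega>)"
    by (simp add: finite_measure_lebesgue_on)
  have meas: "\<phi> \<in> borel_measurable (lebesgue_on \<Omega>)"
    using cont closure_subset \<Omega>
    by (intro continuous_imp_measurable_on_sets_lebesgue) (auto intro: continuous_on_subset)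
  have "compact (\<phi> ` closure \<Omega>)"
    using cont assms by (intro compact_continuous_image) auto
  then obtain B where B: "\<And>x. x \<in> closure \<Omega> \<Longrightarrow> \<bar>\<phi> x\<bar> \<le> B"
    using compact_imp_bounded bounded_iff by (metis imageI real_norm_def)
  have "integrable (lebesgue_on \<Omega>) (\<lambda>x. (\<phi> x)\<^sup>2)"
  proof (rule finite_measure.integrable_const_bound[OF fin])
    have "norm ((\<phi> x)\<^sup>2) \<le> B\<^sup>2" if "x \<in> \<Omega>" for x
      using B[of x] closure_subset[of \<Omega>] that
      by (auto simp: abs_le_square_iff[symmetric])
    then show "AE x in lebesgue_on \<Omega>. norm ((\<phi> x)\<^sup>2) \<le> B\<^sup>2"
      by (intro AE_I2) (simp add: space_restrict_space)
  qed (use meas in simp)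
  with meas show "\<phi> \<in> L2_space \<Omega>"
    by (simp add: L2_space_def)
qed

text \<open>Energy argument for one time step: the equation is tested with \<open>w\<close>, the
  nonnegative gradient term is dropped, Cauchy-Schwarz bounds the right-hand side, and one factor
  \<open>L2_norm \<Omega> w\<close> is cancelled.\<close>

lemma L2_norm_le_of_scheme_step:
  assumes X: "X \<subseteq> L2_space \<Omega>"
    and A: "is_neg_discrete_Laplacian \<Omega> X A"
    and mem: "w \<in> X" "F \<in> X" "\<And>i. i \<in> I \<Longrightarrow> V i \<in> X"
    and fin: "finite I"
    and coeffs: "0 \<le> s" "\<And>i. i \<in> I \<Longrightarrow> 0 \<le> a i"
    and eq: "\<And>x. w x + s * A w x = (\<Sum>i\<in>I. a i * V i x) + s * F x"
  shows "L2_norm \<Omega> w \<le> (\<Sum>i\<in>I. a i * L2_norm \<Omega> (V i)) + s * L2_norm \<Omega> F"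
proof -
  let ?R = "(\<Sum>i\<in>I. a i * L2_norm \<Omega> (V i)) + s * L2_norm \<Omega> F"
  have Aw: "A w \<in> X" "L2_inner \<Omega> (A w) w = grad_inner \<Omega> w w"
    using A mem by (auto simp: is_neg_discrete_Laplacian_def)
  have int: "integrable (lebesgue_on \<Omega>) (\<lambda>x. \<phi> x * w x)" if "\<phi> \<in> X" for \<phi>
    using that mem X by (intro L2_space_integrable_mult) auto
  have CS: "L2_inner \<Omega> \<phi> w \<le> L2_norm \<Omega> \<phi> * L2_norm \<Omega> w" if "\<phi> \<in> X" for \<phi>
    using that mem X by (intro L2_inner_Cauchy_Schwarz) auto
  have "L2_inner \<Omega> w w + s * L2_inner \<Omega> (A w) w
      = (LINT x|lebesgue_on \<Omega>. (w x + s * A w x) * w x)"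
    using int[OF mem(1)] int[OF Aw(1)]
    by (simp add: L2_inner_def distrib_right mult.assoc)
  also have "\<dots> = (LINT x|lebesgue_on \<Omega>. (\<Sum>i\<in>I. a i * (V i x * w x)) + s * (F x * w x))"
    by (simp only: eq) (simp add: algebra_simps sum_distrib_left)
  also have "\<dots> = (\<Sum>i\<in>I. a i * L2_inner \<Omega> (V i) w) + s * L2_inner \<Omega> F w"
    using int mem by (simp add: L2_inner_def)
  also have "\<dots> \<le> (\<Sum>i\<in>I. a i * (L2_norm \<Omega> (V i) * L2_norm \<Omega> w))
      + s * (L2_norm \<Omega> F * L2_norm \<Omega> w)"
    using CS mem coeffs by (intro add_mono sum_mono mult_left_mono) auto
  also have "\<dots> = ?R * L2_norm \<Omega> w"
    by (simp add: sum_distrib_right distrib_right mult.assoc)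
  finally have "L2_norm \<Omega> w * L2_norm \<Omega> w + s * grad_inner \<Omega> w w \<le> ?R * L2_norm \<Omega> w"
    by (simp add: Aw L2_norm_def L2_inner_nonneg)
  then have "L2_norm \<Omega> w * L2_norm \<Omega> w \<le> ?R * L2_norm \<Omega> w"
    using mult_nonneg_nonneg[OF coeffs(1) grad_inner_nonneg[of \<Omega> w]] by linarith
  \<comment> \<open>This settles the case of a vanishing norm of \<open>w\<close>, where no factor
    can be cancelled.\<close>
  moreover have "0 \<le> ?R"
    using coeffs by (intro add_nonneg_nonneg sum_nonneg mult_nonneg_nonneg L2_norm_nonneg) auto
  ultimately show ?thesis
    using L2_norm_nonneg[of \<Omega> w] by (cases "L2_norm \<Omega> w = 0") auto
qed

theorem theorem3p3:
  fixes \<Omega> :: "'a::euclidean_space set" and \<T> :: "'a set set"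
    and X\<^sub>h :: "('a \<Rightarrow> real) set"
    and A\<^sub>h P\<^sub>h :: "('a \<Rightarrow> real) \<Rightarrow> 'a \<Rightarrow> real"
    and f :: "real \<Rightarrow> 'a \<Rightarrow> real" and v\<^sub>h :: "'a \<Rightarrow> real"
    and U F :: "nat \<Rightarrow> 'a \<Rightarrow> real"
    and \<alpha> T \<tau> \<sigma> \<kappa> :: real and N :: nat
  assumes "0 < \<alpha>" and "\<alpha> < 1" and "0 < T" and "1 \<le> N" and "\<tau> = T / real N"
    and "DIM('a) \<in> {1, 2, 3}"
    and "convex_polygonal_domain \<Omega>"
    and "mesh_of \<Omega> \<T>" and "shape_regular \<sigma> \<T>" and "quasi_uniform \<kappa> \<T>"
    and "X\<^sub>h = fe_space \<Omega> \<T>"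
    and "is_neg_discrete_Laplacian \<Omega> X\<^sub>h A\<^sub>h"
    and "is_L2_projection \<Omega> X\<^sub>h P\<^sub>h"
    and "\<And>n. n \<in> {1..N} \<Longrightarrow> f (real n * \<tau>) \<in> L2_space \<Omega>"
    and "\<And>n. n \<in> {1..N} \<Longrightarrow> F n = P\<^sub>h (f (real n * \<tau>))"
    and "v\<^sub>h \<in> X\<^sub>h"
    and "L1_scheme_solution X\<^sub>h A\<^sub>h \<alpha> \<tau> N v\<^sub>h F U"
  shows "\<forall>n\<in>{1..N}. L2_norm \<Omega> (U n) \<le>
     L2_norm \<Omega> v\<^sub>h
     + c_coeff \<alpha> * \<tau> powr \<alpha> * (\<Sum>k=0..n - 1. real (n - k) powr (\<alpha> - 1) * L2_norm \<Omega> (F (k + 1)))"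
proof
  fix n assume n: "n \<in> {1..N}"
  let ?s = "c_coeff \<alpha> * \<tau> powr \<alpha>" and ?b = "L1_coeff \<alpha>"
  have s: "0 \<le> ?s"
    using \<open>\<alpha> < 1\<close> by (simp add: c_coeff_def Gamma_real_pos less_imp_le)
  have X: "X\<^sub>h \<subseteq> L2_space \<Omega>"
    using assms(7,11) by (auto simp: convex_polygonal_domain_def dest: fe_space_subset_L2_space)
  have U0: "U 0 = v\<^sub>h"
    using assms(17) by (simp add: L1_scheme_solution_def)
  have UX: "U m \<in> X\<^sub>h" if "m \<le> N" for m
    using assms(16,17) that U0 by (cases "m = 0") (auto simp: L1_scheme_solution_def)
  have FX: "F m \<in> X\<^sub>h" if "m \<in> {1..N}" for m
    using assms(13-15) that by (simp add: is_L2_projection_def)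
  have step: "L2_norm \<Omega> (U m) \<le> ?b (m - 1) * L2_norm \<Omega> (U 0)
      + (\<Sum>j=1..m - 1. (?b (j - 1) - ?b j) * L2_norm \<Omega> (U (m - j))) + ?s * L2_norm \<Omega> (F m)"
    if m: "1 \<le> m" "m \<le> n" for m
  proof -
    \<comment> \<open>The index \<open>m\<close> carries the coefficient of \<open>U 0\<close>.\<close>
    define a where "a j = (if j = m then ?b (m - 1) else ?b (j - 1) - ?b j)" for j
    have split: "(\<Sum>j=1..m. a j * h j)
        = ?b (m - 1) * h m + (\<Sum>j=1..m - 1. (?b (j - 1) - ?b j) * h j)" for h :: "nat \<Rightarrow> real"
    proof -
      obtain k where k: "m = Suc k" using m not0_implies_Suc by force
      have "(\<Sum>j=1..k. a j * h j) = (\<Sum>j=1..k. (?b (j - 1) - ?b j) * h j)"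
        by (intro sum.cong) (auto simp: a_def k)
      then show ?thesis by (simp add: k a_def)
    qed
    have "L2_norm \<Omega> (U m) \<le> (\<Sum>j=1..m. a j * L2_norm \<Omega> (U (m - j))) + ?s * L2_norm \<Omega> (F m)"
    proof (rule L2_norm_le_of_scheme_step[OF X assms(12)])
      show "0 \<le> a j" if "j \<in> {1..m}" for j
        using L1_coeff_pos[OF \<open>\<alpha> < 1\<close>, of "m - 1"]
          decseqD[OF decseq_L1_coeff, of \<alpha> "j - 1" j] assms(1,2)
        by (auto simp: a_def)
      \<comment> \<open>The leading coefficient of the scheme is \<open>?b 0 = 1\<close>.\<close>
      show "U m x + ?s * A\<^sub>h (U m) x = (\<Sum>j=1..m. a j * U (m - j) x) + ?s * F m x" for x
        unfolding split[of "\<lambda>j. U (m - j) x"]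
        using assms(17) m n by (simp add: L1_scheme_solution_def L1_coeff_0)
    qed (use UX FX m n s in auto)
    then show ?thesis
      by (simp only: split[of "\<lambda>j. L2_norm \<Omega> (U (m - j))"]) simp
  qed
  have "L2_norm \<Omega> (U n) \<le> L2_norm \<Omega> (U 0)
      + (\<Sum>m=1..n. real (n - m + 1) powr (\<alpha> - 1) * (?s * L2_norm \<Omega> (F m)))"
    using assms(1,2) s step
    by (intro L1_convolution_inequality_bound) (auto intro: mult_nonneg_nonneg L2_norm_nonneg)
  \<comment> \<open>The shift \<open>k = m - 1\<close> turns \<open>n - m + 1\<close> into
    \<open>n - k\<close>.\<close>
  also have "(\<Sum>m=1..n. real (n - m + 1) powr (\<alpha> - 1) * (?s * L2_norm \<Omega> (F m)))
      = (\<Sum>k=0..n - 1. real (n - k) powr (\<alpha> - 1) * (?s * L2_norm \<Omega> (F (k + 1))))"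
    using n by (intro sum.reindex_bij_witness[of _ "\<lambda>k. k + 1" "\<lambda>m. m - 1"])
      (auto simp: Suc_diff_le)
  finally show "L2_norm \<Omega> (U n) \<le> L2_norm \<Omega> v\<^sub>h
      + ?s * (\<Sum>k=0..n - 1. real (n - k) powr (\<alpha> - 1) * L2_norm \<Omega> (F (k + 1)))"
    by (simp add: U0 sum_distrib_left mult_ac)
qed

end
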